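(* Let the global unique solvability assumption for the collocation system (stated in the context) hold and suppose that the system $\bm y'=\bm f(\bm y)$ is logarithmically dissipative with constant $\nu\le0$. Assume algebraic stability of the Runge--Kutta scheme with coefficient matrix $Q=(Q_{m,j})_{m,j=0}^M$ and weights $b_j=Q_{M,j}$, that is, $$b_j=Q_{M,j}\ge0\ \text{ for each } j=0,\dots,M,\qquad\text{and}\qquad \bm{\mathcal{M}}=\operatorname{diag}(\bm b)\,Q+Q^\top\operatorname{diag}(\bm b)-\bm b\bm b^\top\ \text{ is positive semi-definite},$$ where $\bm b=[b_0,\dots,b_M]^\top$. Then, for any $h>0$ and any $\bm y,\bm z\in\mathbb{R}^N_+$, $$\operatorname{d}\big(\bm\Psi^h(\bm y),\bm\Psi^h(\bm z)\big)\le\operatorname{d}(\bm y,\bm z).$$ In particular, the collocation map $\bm\Psi^h$ is non-expansive for $\nu=0$ and strictly contractive for $\nu<0$ (i.e. the inequality is strict whenever $\bm y\ne\bm z$).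
   Context: Let $\mathbb{R}^N_+=\{\bm\eta\in\mathbb{R}^N:\eta_i>0\ \forall i\}$. Consider $\bm y'(t)=\bm f(\bm y(t))$, $t\in[0,T]$, $\bm y(0)=\bm y_0\in\mathbb{R}^N_+$, where $\bm f=[f_1,\dots,f_N]^\top$ is a sufficiently smooth $\mathbb{R}^N$-valued function defined on an open set containing $\mathbb{R}^N_+$. Standing assumption: $\mathbb{R}^N_+$ is forward invariant under the flow. Let $M\ge0$ be an integer and let $0\le\tau_0<\tau_1<\dots<\tau_M=1$ be quadrature nodes with Lagrange basis polynomials $\ell_0,\dots,\ell_M$ (of degree at most $M$). Set $Q_{m,j}=\int_0^{\tau_m}\ell_j(\tau)\,d\tau$ for $m,j=0,\dots,M$. Collocation system: for $h>0$ and a given parameter $\bm y^n\in\mathbb{R}^N_+$, the unknown $\bm Y^n=[\bm y^{n,0},\dots,\bm y^{n,M}]$ satisfies $$y_i^{n,m}=y_i^n\exp\Big(h\sum_{j=0}^M Q_{m,j}\frac{f_i(\bm y^{n,j})}{y_i^{n,j}}\Big),\qquad i=1,\dots,N,\ m=0,\dots,M.$$ Global unique solvability assumption: for each $h>0$ and each $\bm y^n\in\mathbb{R}^N_+$ the collocation system admits a unique solution $\tilde{\bm Y}^n=[\tilde{\bm y}^{n,0},\dots,\tilde{\bm y}^{n,M}]\in\mathbb{R}^{N\times(M+1)}_{>0}$ (all entries positive). The collocation map is then $\bm\Psi^h:\mathbb{R}^N_+\to\mathbb{R}^N_+$, $\Psi_i^h(\bm y^n)=\tilde y_i^{n,M}$.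 Logarithmic dissipativity: with $\operatorname{Exp}(\bm u)=[e^{u_1},\dots,e^{u_N}]^\top$, define $\bm G=[G_1,\dots,G_N]^\top:\mathbb{R}^N\to\mathbb{R}^N$ by $G_i(\bm u)=f_i(\operatorname{Exp}(\bm u))/e^{u_i}$. The system is logarithmically dissipative with constant $\nu\in\mathbb{R}$ if $\langle\bm G(\bm u)-\bm G(\bm v),\bm u-\bm v\rangle\le\nu\|\bm u-\bm v\|^2$ for all $\bm u,\bm v\in\mathbb{R}^N$ (Euclidean inner product and norm). Log-Euclidean metric on $\mathbb{R}^N_+$: $\operatorname{d}(\bm y,\bm z)=\|\operatorname{Log}(\bm y)-\operatorname{Log}(\bm z)\|$, with $\operatorname{Log}(\bm v)=[\log v_1,\dots,\log v_N]^\top$. *)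

theory Defs
  imports "HOL-Analysis.Analysis"
begin

definition pos_orthant :: "(real ^ 'n) set" where
  "pos_orthant = {y. \<forall>i. y $ i > 0}"

definition Exp :: "real ^ 'n \<Rightarrow> real ^ 'n" where
  "Exp u = (\<chi> i. exp (u $ i))"

definition Log :: "real ^ 'n \<Rightarrow> real ^ 'n" where
  "Log v = (\<chi> i. ln (v $ i))"

definition log_dist :: "real ^ 'n \<Rightarrow> real ^ 'n \<Rightarrow> real" where
  "log_dist y z = norm (Log y - Log z)"

definition continuously_differentiable_on ::
    "(real ^ 'n \<Rightarrow> real ^ 'n) \<Rightarrow> (real ^ 'n) set \<Rightarrow> bool" where
  "continuously_differentiable_on f S \<longleftrightarrow>
     (\<exists>f' :: real ^ 'n \<Rightarrow> (real ^ 'n) \<Rightarrow>\<^sub>L (real ^ 'n).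
        (\<forall>x\<in>S. (f has_derivative blinfun_apply (f' x)) (at x)) \<and> continuous_on S f')"

text \<open>\<open>S\<close> is the domain of \<open>f\<close>; a solution is only required to stay in \<open>S\<close>, and invariance
  says that it then remains in \<open>P\<close> for as long as it exists.\<close>

definition forward_invariant ::
    "(real ^ 'n \<Rightarrow> real ^ 'n) \<Rightarrow> (real ^ 'n) set \<Rightarrow> (real ^ 'n) set \<Rightarrow> bool" where
  "forward_invariant f S P \<longleftrightarrow>
     (\<forall>T>0. \<forall>y :: real \<Rightarrow> real ^ 'n.
        y 0 \<in> P \<and>
        (\<forall>t\<in>{0..T}. y t \<in> S \<and> (y has_vector_derivative f (y t)) (at t within {0..T}))
        \<longrightarrow> (\<forall>t\<in>{0..T}. y t \<in> P))"

definition log_field :: "(real ^ 'n \<Rightarrow> real ^ 'n) \<Rightarrow> real ^ 'n \<Rightarrow> real ^ 'n" where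
  "log_field f u = (\<chi> i. f (Exp u) $ i / exp (u $ i))"

definition log_dissipative :: "(real ^ 'n \<Rightarrow> real ^ 'n) \<Rightarrow> real \<Rightarrow> bool" where
  "log_dissipative f \<nu> \<longleftrightarrow>
     (\<forall>u v. (log_field f u - log_field f v) \<bullet> (u - v) \<le> \<nu> * (norm (u - v))\<^sup>2)"

text \<open>The \<open>M + 1\<close> nodes are \<open>\<tau> 0, \<dots>, \<tau> M\<close>; values of \<open>\<tau>\<close> beyond \<open>M\<close> are irrelevant.\<close>

definition quadrature_nodes :: "nat \<Rightarrow> (nat \<Rightarrow> real) \<Rightarrow> bool" where
  "quadrature_nodes M \<tau> \<longleftrightarrow> 0 \<le> \<tau> 0 \<and> strict_mono_on {..M} \<tau> \<and> \<tau> M = 1"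

definition lagrange_basis :: "nat \<Rightarrow> (nat \<Rightarrow> real) \<Rightarrow> nat \<Rightarrow> real \<Rightarrow> real" where
  "lagrange_basis M \<tau> j x = (\<Prod>k\<in>{..M} - {j}. (x - \<tau> k) / (\<tau> j - \<tau> k))"

definition quad_coeff :: "nat \<Rightarrow> (nat \<Rightarrow> real) \<Rightarrow> nat \<Rightarrow> nat \<Rightarrow> real" where
  "quad_coeff M \<tau> m j = integral {0..\<tau> m} (lagrange_basis M \<tau> j)"

text \<open>Matrices and vectors of size \<open>M + 1\<close> are functions on indices \<open>0, \<dots>, M\<close>.\<close>

definition pos_semidefinite :: "nat \<Rightarrow> (nat \<Rightarrow> nat \<Rightarrow> real) \<Rightarrow> bool" where
  "pos_semidefinite M A \<longleftrightarrow>
     (\<forall>i\<le>M. \<forall>j\<le>M. A i j = A j i) \<and>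
     (\<forall>x :: nat \<Rightarrow> real. (\<Sum>i\<le>M. \<Sum>j\<le>M. x i * A i j * x j) \<ge> 0)"

text \<open>Entries of \<open>diag(b) Q + Q\<^sup>T diag(b) - b b\<^sup>T\<close>.\<close>

definition stability_matrix ::
    "(nat \<Rightarrow> nat \<Rightarrow> real) \<Rightarrow> (nat \<Rightarrow> real) \<Rightarrow> nat \<Rightarrow> nat \<Rightarrow> real" where
  "stability_matrix Q b i j = b i * Q i j + Q j i * b j - b i * b j"

definition algebraically_stable ::
    "nat \<Rightarrow> (nat \<Rightarrow> nat \<Rightarrow> real) \<Rightarrow> (nat \<Rightarrow> real) \<Rightarrow> bool" where
  "algebraically_stable M Q b \<longleftrightarrow>
     (\<forall>j\<le>M. b j \<ge> 0) \<and> pos_semidefinite M (stability_matrix Q b)"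

text \<open>The unknown \<open>[y\<^sup>0, \<dots>, y\<^sup>M]\<close> is an element of \<open>{..M} \<rightarrow>\<^sub>E pos_orthant\<close>; extensionality
  outside \<open>{..M}\<close> makes uniqueness a statement about the \<open>M + 1\<close> stages only.\<close>

definition collocation_solution ::
    "(real ^ 'n \<Rightarrow> real ^ 'n) \<Rightarrow> nat \<Rightarrow> (nat \<Rightarrow> real) \<Rightarrow> real \<Rightarrow> real ^ 'n \<Rightarrow>
     (nat \<Rightarrow> real ^ 'n) \<Rightarrow> bool" where
  "collocation_solution f M \<tau> h y Y \<longleftrightarrow>
     Y \<in> {..M} \<rightarrow>\<^sub>E pos_orthant \<and>
     (\<forall>m\<le>M. \<forall>i. Y m $ i =
        y $ i * exp (h * (\<Sum>j\<le>M. quad_coeff M \<tau> m j * (f (Y j) $ i / Y j $ i))))"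

definition globally_uniquely_solvable ::
    "(real ^ 'n \<Rightarrow> real ^ 'n) \<Rightarrow> nat \<Rightarrow> (nat \<Rightarrow> real) \<Rightarrow> bool" where
  "globally_uniquely_solvable f M \<tau> \<longleftrightarrow>
     (\<forall>h>0. \<forall>y\<in>pos_orthant. \<exists>!Y. collocation_solution f M \<tau> h y Y)"

definition collocation_map ::
    "(real ^ 'n \<Rightarrow> real ^ 'n) \<Rightarrow> nat \<Rightarrow> (nat \<Rightarrow> real) \<Rightarrow> real \<Rightarrow> real ^ 'n \<Rightarrow> real ^ 'n" where
  "collocation_map f M \<tau> h y = (THE Y. collocation_solution f M \<tau> h y Y) M"

definition log_nonexpansive :: "(real ^ 'n \<Rightarrow> real ^ 'n) \<Rightarrow> bool" where
  "log_nonexpansive F \<longleftrightarrow>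
     (\<forall>y\<in>pos_orthant. \<forall>z\<in>pos_orthant. log_dist (F y) (F z) \<le> log_dist y z)"

definition log_strictly_contractive :: "(real ^ 'n \<Rightarrow> real ^ 'n) \<Rightarrow> bool" where
  "log_strictly_contractive F \<longleftrightarrow>
     (\<forall>y\<in>pos_orthant. \<forall>z\<in>pos_orthant. y \<noteq> z \<longrightarrow> log_dist (F y) (F z) < log_dist y z)"

end

theory Submission
  imports Defs "HOL-Computational_Algebra.Polynomial"
begin

text \<open>
  Why the theorem is true. In the variables \<open>u = Log y\<close> the exponential collocation scheme becomes
  an ordinary Runge--Kutta scheme for the field \<open>G = log_field f\<close>
  (lemma \<open>Log_collocation_solution\<close>), the log-Euclidean metric becomes the Euclidean one, and
  logarithmic dissipativity becomes the usual one-sided Lipschitz condition on \<open>G\<close>. What remains is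
  the classical argument that algebraic stability implies B-stability.

  For two runs of the scheme let \<open>d\<close> be the difference of the initial values, \<open>\<delta>\<^sub>m\<close> that of the
  stages and \<open>g\<^sub>m\<close> that of the values of \<open>G\<close> at the stages, so that
  \<open>\<delta>\<^sub>m = d + h \<Sum>\<^sub>j Q\<^sub>m\<^sub>j g\<^sub>j\<close>. Expanding the square of \<open>d + h \<Sum>\<^sub>j b\<^sub>j g\<^sub>j\<close> and eliminating \<open>d\<close> from the
  mixed terms by means of the stage equations gives (lemma \<open>runge_kutta_energy_identity\<close>)

  \<open>|d + h \<Sum>\<^sub>j b\<^sub>j g\<^sub>j|\<^sup>2 = |d|\<^sup>2 + 2h \<Sum>\<^sub>j b\<^sub>j \<langle>g\<^sub>j, \<delta>\<^sub>j\<rangle> - h\<^sup>2 \<Sum>\<^sub>i \<Sum>\<^sub>j \<M>\<^sub>i\<^sub>j \<langle>g\<^sub>i, g\<^sub>j\<rangle>\<close>.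

  Semidefiniteness of \<open>\<M>\<close> makes the last term harmless (lemma \<open>pos_semidefinite_gram_nonneg\<close>), and
  dissipativity together with \<open>b\<^sub>j \<ge> 0\<close> bounds the middle one by \<open>2h\<nu> \<Sum>\<^sub>j b\<^sub>j |\<delta>\<^sub>j|\<^sup>2 \<le> 0\<close>.
  Because the last node is \<open>1\<close> and \<open>b\<close> is the last row of \<open>Q\<close>, the left side is the squared distance
  of the two collocation values.

  For \<open>\<nu> < 0\<close>, equality forces \<open>\<delta>\<^sub>j = 0\<close>, hence \<open>g\<^sub>j = 0\<close>, at every stage with \<open>b\<^sub>j > 0\<close>. Weights
  may vanish, so this does not by itself control all stages. But the stages of weight zero are
  invisible to the others: \<open>b\<^sub>j = 0\<close> makes the diagonal entry \<open>\<M>\<^sub>j\<^sub>j\<close> vanish, thus the whole column by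
  semidefiniteness, and this column is \<open>b\<^sub>i Q\<^sub>i\<^sub>j\<close>; so \<open>Q\<^sub>i\<^sub>j = 0\<close> when \<open>b\<^sub>i > 0 = b\<^sub>j\<close>. Hence any stage
  with \<open>b\<^sub>i > 0\<close> yields \<open>0 = \<delta>\<^sub>i = d\<close>. Such a stage exists since the weights sum to
  \<open>1\<close> (lemma \<open>quad_coeff_sum\<close>).
\<close>

section \<open>Positive semidefinite matrices\<close>

text \<open>The vector-valued quadratic form splits over an orthonormal basis into scalar ones.\<close>

lemma pos_semidefinite_gram_nonneg:
  fixes g :: "nat \<Rightarrow> 'a :: euclidean_space"
  assumes "pos_semidefinite M A"
  shows "0 \<le> (\<Sum>i\<le>M. \<Sum>j\<le>M. A i j * (g i \<bullet> g j))"
proof -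
  have "(\<Sum>i\<le>M. \<Sum>j\<le>M. A i j * (g i \<bullet> g j)) =
      (\<Sum>i\<le>M. \<Sum>j\<le>M. \<Sum>e\<in>Basis. (g i \<bullet> e) * A i j * (g j \<bullet> e))"
    by (intro sum.cong refl)
      (subst euclidean_inner, simp add: sum_distrib_left mult_ac)
  also have "\<dots> = (\<Sum>i\<le>M. \<Sum>e\<in>Basis. \<Sum>j\<le>M. (g i \<bullet> e) * A i j * (g j \<bullet> e))"
    by (intro sum.cong refl sum.swap)
  also have "\<dots> = (\<Sum>e\<in>Basis. \<Sum>i\<le>M. \<Sum>j\<le>M. (g i \<bullet> e) * A i j * (g j \<bullet> e))"
    by (rule sum.swap)
  also have "\<dots> \<ge> 0"
    using assms by (intro sum_nonneg [of Basis]) (simp add: pos_semidefinite_def)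
  finally show ?thesis .
qed

text \<open>Since \<open>A\<^sub>j\<^sub>j = 0\<close>, the quadratic form at \<open>e\<^sub>i + t e\<^sub>j\<close> is affine in \<open>t\<close> with slope \<open>2 A\<^sub>i\<^sub>j\<close>, and an
  affine function bounded below is constant.\<close>

lemma pos_semidefinite_zero_diagonal_imp_zero_column:
  assumes psd: "pos_semidefinite M A" and ij: "i \<le> M" "j \<le> M" and diag: "A j j = 0"
  shows "A i j = 0"
proof -
  have sym: "A j i = A i j"
    using psd ij by (auto simp: pos_semidefinite_def)
  have affine: "0 \<le> A i i + 2 * t * A i j" for t :: real
  proof -
    define x :: "nat \<Rightarrow> real" where
      "x k = (if k = i then 1 else 0) + (if k = j then t else 0)" for k
    have collapse: "(\<Sum>k\<le>M. x k * F k) = F i + t * F j" for F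
    proof -
      have "(\<Sum>k\<le>M. x k * F k) =
          (\<Sum>k\<le>M. if k = i then F k else 0) + (\<Sum>k\<le>M. if k = j then t * F k else 0)"
        unfolding x_def sum.distrib [symmetric] by (intro sum.cong) (auto simp: algebra_simps)
      also have "\<dots> = F i + t * F j"
        using ij by (simp only: sum.delta' sum.delta finite_atMost) simp
      finally show ?thesis .
    qed
    have "(\<Sum>k\<le>M. \<Sum>l\<le>M. x k * A k l * x l) = (\<Sum>k\<le>M. x k * (\<Sum>l\<le>M. x l * A k l))"
      by (simp add: sum_distrib_left mult_ac)
    also have "\<dots> = A i i + 2 * t * A i j"
      unfolding collapse using sym diag by (simp add: algebra_simps)
    moreover have "0 \<le> (\<Sum>k\<le>M. \<Sum>l\<le>M. x k * A k l * x l)"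
      using psd by (simp add: pos_semidefinite_def)
    ultimately show ?thesis
      by simp
  qed
  show ?thesis
  proof (rule ccontr)
    assume "A i j \<noteq> 0"
    \<comment> \<open>At this \<open>t\<close> the affine function takes the value \<open>- 1\<close>.\<close>
    then show False
      using affine [of "- (A i i + 1) / (2 * A i j)"] by (simp add: field_simps)
  qed
qed

lemma algebraically_stable_zero_weight_decouples:
  assumes stable: "algebraically_stable M Q b"
    and ij: "i \<le> M" "j \<le> M" and "b i > 0" "b j = 0"
  shows "Q i j = 0"
proof -
  have "pos_semidefinite M (stability_matrix Q b)"
    using stable by (simp only: algebraically_stable_def)
  moreover have "stability_matrix Q b j j = 0"
    using \<open>b j = 0\<close> by (simp add: stability_matrix_def)
  ultimately have "stability_matrix Q b i j = 0"
    using ij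
    by (blast intro: pos_semidefinite_zero_diagonal_imp_zero_column [of M "stability_matrix Q b"])
  then show ?thesis
    using \<open>b i > 0\<close> \<open>b j = 0\<close> by (simp add: stability_matrix_def)
qed

section \<open>The weights of interpolatory quadrature\<close>

text \<open>Both sides are polynomials of degree at most \<open>M\<close> in \<open>x\<close>, and they agree at the \<open>M + 1\<close> nodes.\<close>

lemma lagrange_basis_sum:
  assumes inj: "inj_on \<tau> {..M}"
  shows "(\<Sum>j\<le>M. lagrange_basis M \<tau> j x) = 1"
proof -
  define L where
    "L j = (\<Prod>k\<in>{..M} - {j}. smult (inverse (\<tau> j - \<tau> k)) [:- \<tau> k, 1:])" for j
  have poly_L: "poly (L j) t = lagrange_basis M \<tau> j t" for j t
    by (simp add: L_def lagrange_basis_def poly_prod divide_inverse algebra_simps)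
  define p where "p = (\<Sum>j\<le>M. L j) - 1"
  have "degree (L j) \<le> M" if "j \<le> M" for j
  proof -
    have "degree (L j) \<le> (\<Sum>k\<in>{..M} - {j}. degree (smult (inverse (\<tau> j - \<tau> k)) [:- \<tau> k, 1:]))"
      unfolding L_def by (rule order_trans [OF degree_prod_sum_le]) simp_all
    also have "\<dots> \<le> (\<Sum>k\<in>{..M} - {j}. 1)"
      by (intro sum_mono) simp
    also have "\<dots> = M"
      using that by simp
    finally show ?thesis .
  qed
  then have deg: "degree p \<le> M"
    unfolding p_def by (intro degree_diff_le degree_sum_le) auto
  have root: "poly p (\<tau> m) = 0" if "m \<le> M" for m
  proof -
    have "lagrange_basis M \<tau> j (\<tau> m) = (if j = m then 1 else 0)" if "j \<le> M" for j
    proof (cases "j = m")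
      case True
      have "(\<Prod>k\<in>{..M} - {m}. (\<tau> m - \<tau> k) / (\<tau> m - \<tau> k)) = 1"
        using inj \<open>m \<le> M\<close> by (intro prod.neutral) (auto simp: inj_on_def)
      then show ?thesis
        using True by (simp add: lagrange_basis_def)
    next
      case False
      then show ?thesis
        using \<open>m \<le> M\<close> unfolding lagrange_basis_def by (auto intro!: prod_zero)
    qed
    then show ?thesis
      using that by (simp add: p_def poly_sum poly_L)
  qed
  have "p = 0"
  proof (rule ccontr)
    assume "p \<noteq> 0"
    have "Suc M = card (\<tau> ` {..M})"
      using inj by (simp add: card_image)
    also have "\<dots> \<le> card {t. poly p t = 0}"
      using root \<open>p \<noteq> 0\<close> by (intro card_mono poly_roots_finite) auto
    also have "\<dots> \<le> degree p"
      using \<open>p \<noteq> 0\<close> by (rule card_poly_roots_bound)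
    finally show False
      using deg by simp
  qed
  then have "poly p x = 0"
    by simp
  then show ?thesis
    by (simp add: p_def poly_sum poly_L)
qed

lemma quad_coeff_sum:
  assumes "quadrature_nodes M \<tau>"
  shows "(\<Sum>j\<le>M. quad_coeff M \<tau> M j) = 1"
proof -
  have inj: "inj_on \<tau> {..M}"
    using assms by (auto simp: quadrature_nodes_def intro: strict_mono_on_imp_inj_on)
  have "lagrange_basis M \<tau> j integrable_on {0..1}" for j
    unfolding lagrange_basis_def [abs_def]
    by (simp only: divide_inverse, intro integrable_continuous_real continuous_on_prod
        continuous_on_mult continuous_on_diff continuous_on_id continuous_on_const)
  then have "(\<Sum>j\<le>M. quad_coeff M \<tau> M j) =
      integral {0..1} (\<lambda>x. \<Sum>j\<le>M. lagrange_basis M \<tau> j x)"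
    using assms by (simp add: quad_coeff_def quadrature_nodes_def integral_sum)
  also have "\<dots> = 1"
    by (simp add: lagrange_basis_sum [OF inj])
  finally show ?thesis .
qed

section \<open>Contractivity of algebraically stable Runge--Kutta schemes\<close>

text \<open>The purely algebraic core of B-stability: \<open>d\<close> and \<open>\<delta>\<close> are the differences of initial values and
  stages of two runs, \<open>g\<close> those of the field at the stages.\<close>

lemma runge_kutta_energy_identity:
  fixes d :: "'a :: real_inner"
  assumes stage: "\<And>m. m \<le> M \<Longrightarrow> \<delta> m = d + h *\<^sub>R (\<Sum>j\<le>M. Q m j *\<^sub>R g j)"
  shows "(norm (d + h *\<^sub>R (\<Sum>j\<le>M. b j *\<^sub>R g j)))\<^sup>2 =
    (norm d)\<^sup>2 + 2 * h * (\<Sum>j\<le>M. b j * (g j \<bullet> \<delta> j))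
      - h\<^sup>2 * (\<Sum>i\<le>M. \<Sum>j\<le>M. stability_matrix Q b i j * (g i \<bullet> g j))"
proof -
  let ?B = "\<Sum>i\<le>M. \<Sum>j\<le>M. b i * b j * (g i \<bullet> g j)"
  let ?C = "\<Sum>i\<le>M. \<Sum>j\<le>M. b i * Q i j * (g i \<bullet> g j)"
  let ?D = "\<Sum>j\<le>M. b j * (g j \<bullet> d)"
  have "(norm (d + h *\<^sub>R (\<Sum>j\<le>M. b j *\<^sub>R g j)))\<^sup>2 =
      (norm d)\<^sup>2 + 2 * h * ((\<Sum>j\<le>M. b j *\<^sub>R g j) \<bullet> d)
        + h\<^sup>2 * ((\<Sum>i\<le>M. b i *\<^sub>R g i) \<bullet> (\<Sum>j\<le>M. b j *\<^sub>R g j))"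
    unfolding power2_norm_eq_inner inner_add_left inner_add_right
    by (simp add: inner_commute power2_eq_square algebra_simps)
  also have "(\<Sum>i\<le>M. b i *\<^sub>R g i) \<bullet> (\<Sum>j\<le>M. b j *\<^sub>R g j) = ?B"
    by (simp add: inner_sum_left inner_sum_right mult.assoc sum_distrib_left)
      (simp add: mult.left_commute inner_commute)
  also have "(\<Sum>j\<le>M. b j *\<^sub>R g j) \<bullet> d = ?D"
    by (simp add: inner_sum_left)
  finally have expand: "(norm (d + h *\<^sub>R (\<Sum>j\<le>M. b j *\<^sub>R g j)))\<^sup>2 =
      (norm d)\<^sup>2 + 2 * h * ?D + h\<^sup>2 * ?B" .
  have "(\<Sum>j\<le>M. b j * (g j \<bullet> \<delta> j)) =
      (\<Sum>i\<le>M. b i * (g i \<bullet> d) + h * (\<Sum>j\<le>M. b i * Q i j * (g i \<bullet> g j)))"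
    by (intro sum.cong refl)
      (simp add: stage inner_add_right inner_sum_right sum_distrib_left algebra_simps)
  then have mixed: "(\<Sum>j\<le>M. b j * (g j \<bullet> \<delta> j)) = ?D + h * ?C"
    by (simp add: sum.distrib sum_distrib_left)
  have "(\<Sum>i\<le>M. \<Sum>j\<le>M. Q j i * b j * (g i \<bullet> g j)) = ?C"
    by (subst sum.swap) (simp add: inner_commute mult_ac)
  then have "(\<Sum>i\<le>M. \<Sum>j\<le>M. stability_matrix Q b i j * (g i \<bullet> g j)) = 2 * ?C - ?B"
    by (simp add: stability_matrix_def ring_distribs sum.distrib sum_subtractf)
  then have form: "h\<^sup>2 * (\<Sum>i\<le>M. \<Sum>j\<le>M. stability_matrix Q b i j * (g i \<bullet> g j)) =
      h\<^sup>2 * (2 * ?C - ?B)"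
    by (rule arg_cong)
  show ?thesis
    unfolding expand mixed form by (simp add: power2_eq_square algebra_simps)
qed

lemma algebraically_stable_contraction_estimate:
  fixes d :: "'a :: euclidean_space"
  assumes stable: "algebraically_stable M Q b" and "h > 0"
    and stage: "\<And>m. m \<le> M \<Longrightarrow> \<delta> m = d + h *\<^sub>R (\<Sum>j\<le>M. Q m j *\<^sub>R g j)"
    and dissipative: "\<And>j. j \<le> M \<Longrightarrow> g j \<bullet> \<delta> j \<le> \<nu> * (norm (\<delta> j))\<^sup>2"
  shows "(norm (d + h *\<^sub>R (\<Sum>j\<le>M. b j *\<^sub>R g j)))\<^sup>2 \<le>
    (norm d)\<^sup>2 + 2 * h * \<nu> * (\<Sum>j\<le>M. b j * (norm (\<delta> j))\<^sup>2)"
proof -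
  have "(\<Sum>j\<le>M. b j * (g j \<bullet> \<delta> j)) \<le> (\<Sum>j\<le>M. b j * (\<nu> * (norm (\<delta> j))\<^sup>2))"
    using stable dissipative
    by (intro sum_mono mult_left_mono) (auto simp: algebraically_stable_def)
  also have "\<dots> = \<nu> * (\<Sum>j\<le>M. b j * (norm (\<delta> j))\<^sup>2)"
    by (simp add: sum_distrib_left mult.left_commute)
  finally have "2 * h * (\<Sum>j\<le>M. b j * (g j \<bullet> \<delta> j)) \<le>
      2 * h * (\<nu> * (\<Sum>j\<le>M. b j * (norm (\<delta> j))\<^sup>2))"
    using \<open>h > 0\<close> by (intro mult_left_mono) auto
  moreover have "0 \<le> h\<^sup>2 * (\<Sum>i\<le>M. \<Sum>j\<le>M. stability_matrix Q b i j * (g i \<bullet> g j))"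
    using stable by (auto simp: algebraically_stable_def intro!: mult_nonneg_nonneg
        pos_semidefinite_gram_nonneg)
  moreover note runge_kutta_energy_identity [OF stage, where b = b]
  ultimately show ?thesis
    by (simp add: mult.assoc)
qed

text \<open>A stage of positive weight is driven only by stages of positive weight, so if the runs agree at
  all of these, they start from the same value.\<close>

lemma algebraically_stable_weighted_stages_determine_start:
  fixes d :: "'a :: real_inner"
  assumes stable: "algebraically_stable M Q b" and nonzero: "\<exists>i\<le>M. b i \<noteq> 0"
    and stage: "\<And>m. m \<le> M \<Longrightarrow> \<delta> m = d + h *\<^sub>R (\<Sum>j\<le>M. Q m j *\<^sub>R g j)"
    and field_agrees: "\<And>j. j \<le> M \<Longrightarrow> \<delta> j = 0 \<Longrightarrow> g j = 0"
    and agree: "(\<Sum>j\<le>M. b j * (norm (\<delta> j))\<^sup>2) = 0"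
  shows "d = 0"
proof -
  have nonneg: "b j \<ge> 0" if "j \<le> M" for j
    using stable that by (simp add: algebraically_stable_def)
  then have "\<forall>j\<in>{..M}. b j * (norm (\<delta> j))\<^sup>2 = 0"
    using agree by (subst (asm) sum_nonneg_eq_0_iff) auto
  then have vanish: "\<delta> j = 0" if "j \<le> M" "b j > 0" for j
    using that by (metis atMost_iff less_irrefl mult_eq_0_iff norm_eq_zero zero_eq_power2)
  obtain i where i: "i \<le> M" "b i > 0"
    using nonzero nonneg by (metis order_le_less)
  have "\<forall>j\<in>{..M}. Q i j *\<^sub>R g j = 0"
  proof
    fix j assume "j \<in> {..M}"
    then have j: "j \<le> M"
      by simp
    show "Q i j *\<^sub>R g j = 0"
    proof (cases "b j = 0")
      case True
      then show ?thesis
        using algebraically_stable_zero_weight_decouples [OF stable i(1) j i(2)] by simp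
    next
      case False
      then have "g j = 0"
        using nonneg [OF j] j by (intro field_agrees vanish) auto
      then show ?thesis
        by simp
    qed
  qed
  then have "\<delta> i = d"
    using stage [OF i(1)] by (simp only: sum.neutral scaleR_zero_right add_0_right)
  then show ?thesis
    using vanish [OF i] by simp
qed

section \<open>The collocation scheme in logarithmic variables\<close>

lemma Exp_Log: "y \<in> pos_orthant \<Longrightarrow> Exp (Log y) = y"
  by (simp add: Exp_def Log_def pos_orthant_def vec_eq_iff)

lemma Log_collocation_solution:
  assumes sol: "collocation_solution f M \<tau> h y Y" and y: "y \<in> pos_orthant" and m: "m \<le> M"
  shows "Log (Y m) =
    Log y + h *\<^sub>R (\<Sum>j\<le>M. quad_coeff M \<tau> m j *\<^sub>R log_field f (Log (Y j)))"
proof -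
  have pos: "Y j \<in> pos_orthant" if "j \<le> M" for j
    using sol that by (auto simp: collocation_solution_def)
  have field: "log_field f (Log (Y j)) $ i = f (Y j) $ i / Y j $ i" if "j \<le> M" for i j
    using pos [OF that] Exp_Log [OF pos [OF that]]
    by (simp add: log_field_def Log_def pos_orthant_def)
  have "ln (Y m $ i) = ln (y $ i) +
      h * (\<Sum>j\<le>M. quad_coeff M \<tau> m j * (f (Y j) $ i / Y j $ i))" for i
  proof -
    have "Y m $ i = y $ i * exp (h * (\<Sum>j\<le>M. quad_coeff M \<tau> m j * (f (Y j) $ i / Y j $ i)))"
      using sol m by (auto simp: collocation_solution_def)
    moreover have "y $ i > 0"
      using y by (simp add: pos_orthant_def)
    ultimately show ?thesis
      by (simp add: ln_mult)
  qed
  then show ?thesis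
    by (simp add: vec_eq_iff Log_def sum_component) (simp add: field [unfolded Log_def])
qed

lemma collocation_map_stages:
  assumes "globally_uniquely_solvable f M \<tau>" and "h > 0" and "y \<in> pos_orthant"
  obtains Y where "collocation_solution f M \<tau> h y Y" and "collocation_map f M \<tau> h y = Y M"
proof -
  have "\<exists>!Y. collocation_solution f M \<tau> h y Y"
    using assms by (simp add: globally_uniquely_solvable_def)
  then have "collocation_solution f M \<tau> h y (THE Y. collocation_solution f M \<tau> h y Y)"
    by (rule theI')
  then show ?thesis
    by (rule that) (simp add: collocation_map_def)
qed

lemma log_dist_collocation_map_le:
  assumes nodes: "quadrature_nodes M \<tau>"
    and solvable: "globally_uniquely_solvable f M \<tau>"
    and dissipative: "log_dissipative f \<nu>" and "\<nu> \<le> 0"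
    and stable: "algebraically_stable M (quad_coeff M \<tau>) (quad_coeff M \<tau> M)"
    and "h > 0" and y: "y \<in> pos_orthant" and z: "z \<in> pos_orthant"
  shows log_dist_collocation_map_nonexpansive:
      "log_dist (collocation_map f M \<tau> h y) (collocation_map f M \<tau> h z) \<le> log_dist y z"
    and log_dist_collocation_map_contractive:
      "\<nu> < 0 \<Longrightarrow> y \<noteq> z \<Longrightarrow>
        log_dist (collocation_map f M \<tau> h y) (collocation_map f M \<tau> h z) < log_dist y z"
proof -
  let ?Q = "quad_coeff M \<tau>"
  let ?b = "?Q M"
  obtain Y where Y: "collocation_solution f M \<tau> h y Y" "collocation_map f M \<tau> h y = Y M"
    using collocation_map_stages solvable \<open>h > 0\<close> y by blast
  obtain Z where Z: "collocation_solution f M \<tau> h z Z" "collocation_map f M \<tau> h z = Z M"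
    using collocation_map_stages solvable \<open>h > 0\<close> z by blast
  define d where "d = Log y - Log z"
  define \<delta> where "\<delta> m = Log (Y m) - Log (Z m)" for m
  define g where "g m = log_field f (Log (Y m)) - log_field f (Log (Z m))" for m
  let ?S = "\<Sum>j\<le>M. ?b j * (norm (\<delta> j))\<^sup>2"
  have stage: "\<delta> m = d + h *\<^sub>R (\<Sum>j\<le>M. ?Q m j *\<^sub>R g j)" if "m \<le> M" for m
    using Log_collocation_solution [OF Y(1) y that] Log_collocation_solution [OF Z(1) z that]
    by (simp add: d_def \<delta>_def g_def scaleR_diff_right sum_subtractf)
  have diss: "g j \<bullet> \<delta> j \<le> \<nu> * (norm (\<delta> j))\<^sup>2" for j
    using dissipative by (simp add: g_def \<delta>_def log_dissipative_def)
  have estimate: "(norm (\<delta> M))\<^sup>2 \<le> (norm d)\<^sup>2 + 2 * h * \<nu> * ?S"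
    using algebraically_stable_contraction_estimate [OF stable \<open>h > 0\<close> stage diss]
    by (simp add: stage [of M])
  have S: "?S \<ge> 0"
    using stable by (auto simp: algebraically_stable_def intro!: sum_nonneg)
  have dist: "log_dist (collocation_map f M \<tau> h y) (collocation_map f M \<tau> h z) = norm (\<delta> M)"
    "log_dist y z = norm d"
    by (simp_all add: log_dist_def Y Z d_def \<delta>_def)
  have "2 * h * \<nu> * ?S \<le> 0"
    using S \<open>h > 0\<close> \<open>\<nu> \<le> 0\<close> by (intro mult_nonpos_nonneg mult_nonneg_nonpos) auto
  then have "(norm (\<delta> M))\<^sup>2 \<le> (norm d)\<^sup>2"
    using estimate by linarith
  then show "log_dist (collocation_map f M \<tau> h y) (collocation_map f M \<tau> h z) \<le> log_dist y z"
    unfolding dist by (rule power2_le_imp_le) simp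
  show "log_dist (collocation_map f M \<tau> h y) (collocation_map f M \<tau> h z) < log_dist y z"
    if "\<nu> < 0" "y \<noteq> z"
  proof -
    have "d \<noteq> 0"
      using \<open>y \<noteq> z\<close> Exp_Log [OF y] Exp_Log [OF z] by (auto simp: d_def)
    have "\<exists>i\<le>M. ?b i \<noteq> 0"
      using quad_coeff_sum [OF nodes] by (metis atMost_iff sum.neutral zero_neq_one)
    moreover have "g j = 0" if "\<delta> j = 0" for j
      using that by (simp add: g_def \<delta>_def)
    ultimately have "?S \<noteq> 0"
      using algebraically_stable_weighted_stages_determine_start [OF stable _ stage] \<open>d \<noteq> 0\<close>
      by blast
    with S have "2 * h * \<nu> * ?S < 0"
      using \<open>h > 0\<close> \<open>\<nu> < 0\<close> by (intro mult_neg_pos mult_pos_neg) auto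
    then have "(norm (\<delta> M))\<^sup>2 < (norm d)\<^sup>2"
      using estimate by linarith
    then show ?thesis
      unfolding dist by (rule power2_less_imp_less) simp
  qed
qed

theorem theorem5p5:
  fixes f :: "real ^ 'n \<Rightarrow> real ^ 'n"
    and S :: "(real ^ 'n) set"
    and M :: nat
    and \<tau> :: "nat \<Rightarrow> real"
    and \<nu> :: real
  assumes "open S" and "pos_orthant \<subseteq> S"
    and "continuously_differentiable_on f S"
    and "forward_invariant f S pos_orthant"
    and "quadrature_nodes M \<tau>"
    and "globally_uniquely_solvable f M \<tau>"
    and "log_dissipative f \<nu>" and "\<nu> \<le> 0"
    and "algebraically_stable M (quad_coeff M \<tau>) (quad_coeff M \<tau> M)"
  shows "(\<forall>h>0. \<forall>y\<in>pos_orthant. \<forall>z\<in>pos_orthant.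
            log_dist (collocation_map f M \<tau> h y) (collocation_map f M \<tau> h z) \<le> log_dist y z) \<and>
         (\<nu> = 0 \<longrightarrow> (\<forall>h>0. log_nonexpansive (collocation_map f M \<tau> h))) \<and>
         (\<nu> < 0 \<longrightarrow> (\<forall>h>0. log_strictly_contractive (collocation_map f M \<tau> h)))"
  unfolding log_nonexpansive_def log_strictly_contractive_def
  by (intro conjI allI ballI impI
      log_dist_collocation_map_nonexpansive [OF assms(5-9)]
      log_dist_collocation_map_contractive [OF assms(5-9)])

end
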